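(* Let $a_{n,k}^{\mathrm{pk}}(321)$ denote the number of permutations of $\{1,\dots,n\}$ that avoid the pattern $321$ and have exactly $k$ peaks. Then, as formal power series, $$\sum_{n \geq 0} \sum_{k \geq 0} a_{n,k}^{\mathrm{pk}}(321)\, q^k z^n = 1+z\left(-\dfrac{-1+\sqrt{-4z^2q+4z^2-4z+1}}{2z(zq-z+1)}\right)^2.$$
   Context: $\mathcal{S}_n$ is the set of permutations $\pi=\pi_1\cdots\pi_n$ of $\{1,\dots,n\}$; $\mathcal{S}_0$ consists of the empty permutation, which has $0$ peaks and avoids every nonempty pattern. For $\rho\in\mathcal{S}_m$, $\pi\in\mathcal{S}_n$ contains $\rho$ if there are indices $1\le i_1<\cdots<i_m\le n$ such that $\pi_{i_a}<\pi_{i_b}$ if and only if $\rho_a<\rho_b$; otherwise $\pi$ avoids $\rho$. The number of peaks is $\mathrm{pk}(\pi)=|\{i : \pi_i<\pi_{i+1}\text{ and }\pi_{i+1}>\pi_{i+2}\}|$, where $1\le i\le n-2$. The right-hand side is read as a formal power series in $z$ with coefficients in $\mathbb{Q}[q]$, where the square root is the one with constant term $1$. *)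

theory Defs
  imports
    "HOL-Computational_Algebra.Computational_Algebra"
    "HOL-Combinatorics.Multiset_Permutations"
begin

text \<open>
  A permutation of \<open>{1..n}\<close> is given in one-line notation, as a member of the list set
  \<open>permutations_of_set {1..n}\<close>; list positions are counted from 0.
\<close>

definition contains_pattern :: "nat list \<Rightarrow> nat list \<Rightarrow> bool" where
  "contains_pattern p r \<longleftrightarrow>
     (\<exists>f :: nat \<Rightarrow> nat. strict_mono_on {..<length r} f \<and> (\<forall>a<length r. f a < length p) \<and>
        (\<forall>a<length r. \<forall>b<length r. p ! f a < p ! f b \<longleftrightarrow> r ! a < r ! b))"

abbreviation avoids_pattern :: "nat list \<Rightarrow> nat list \<Rightarrow> bool" where
  "avoids_pattern p r \<equiv> \<not> contains_pattern p r"

definition pk :: "nat list \<Rightarrow> nat" where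
  "pk p = card {i. i + 2 < length p \<and> p ! i < p ! (i + 1) \<and> p ! (i + 1) > p ! (i + 2)}"

definition a_pk :: "nat list \<Rightarrow> nat \<Rightarrow> nat \<Rightarrow> nat" where
  "a_pk r n k = card {p \<in> permutations_of_set {1..n}. avoids_pattern p r \<and> pk p = k}"

text \<open>
  A permutation of length \<open>n\<close> has at most \<open>n\<close> peaks, so the sum over all \<open>k\<close> may be cut off at \<open>n\<close>.
\<close>

lemma pk_le_length: "pk p \<le> length p"
proof -
  have "pk p \<le> card {..<length p}"
    unfolding pk_def by (rule card_mono) auto
  then show ?thesis by simp
qed

lemma a_pk_eq_0:
  assumes "n < k"
  shows "a_pk r n k = 0"
proof -
  have "pk p \<noteq> k" if "p \<in> permutations_of_set {1..n}" for p
    using that pk_le_length[of p] length_finite_permutations_of_set[of p "{1..n}"] assms by simp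
  then have "{p \<in> permutations_of_set {1..n}. avoids_pattern p r \<and> pk p = k} = {}"
    by blast
  then show ?thesis
    unfolding a_pk_def by (simp only: card.empty)
qed

definition pk_poly :: "nat list \<Rightarrow> nat \<Rightarrow> rat poly" where
  "pk_poly r n = (\<Sum>k\<le>n. monom (of_nat (a_pk r n k)) k)"

lemma coeff_pk_poly: "coeff (pk_poly r n) k = of_nat (a_pk r n k)"
  by (simp add: pk_poly_def coeff_sum a_pk_eq_0)

text \<open>
  Division and radicals of formal power series need a field of coefficients, so power series in
  \<open>z\<close> over \<open>\<rat>[q]\<close> are regarded as power series over its fraction field via the embedding
  \<open>to_fract\<close>.
\<close>

definition pk_gf :: "nat list \<Rightarrow> rat poly fract fps" where
  "pk_gf r = Abs_fps (\<lambda>n. to_fract (pk_poly r n))"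

abbreviation z_var :: "rat poly fract fps" where
  "z_var \<equiv> fps_X"

abbreviation q_var :: "rat poly fract fps" where
  "q_var \<equiv> fps_const (to_fract [:0, 1:])"

text \<open>
  The first argument of \<open>fps_radical\<close> chooses the constant term of the root, here 1.
\<close>

abbreviation fps_sqrt :: "rat poly fract fps \<Rightarrow> rat poly fract fps" where
  "fps_sqrt f \<equiv> fps_radical (\<lambda>_ _. 1) 2 f"

lemma fps_sqrt_iff:
  assumes "f $ 0 = 1"
  shows "g = fps_sqrt f \<longleftrightarrow> g ^ 2 = f \<and> g $ 0 = 1"
proof -
  have "fps_sqrt f $ 0 = 1"
    by (simp add: fps_radical_def numeral_2_eq_2)
  moreover have "g ^ 2 = f \<longleftrightarrow> g = fps_sqrt f" if "g $ 0 = 1" for g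
    using radical_unique[of "\<lambda>_ _. 1" 1 f g] assms that by (simp add: numeral_2_eq_2)
  ultimately show ?thesis by auto
qed

end

theory Submission
  imports Defs
begin

text \<open>
  Read a \<open>321\<close>-avoiding permutation from left to right, and let \<open>m\<close> be the maximum so far and \<open>h\<close> the
  number of values below \<open>m\<close> that are still missing. The next entry is either a new maximum, which
  turns \<open>h\<close> into an arbitrary larger or equal height, or the least missing value, which turns \<open>h\<close>
  into \<open>h - 1\<close>. A peak is a new maximum, other than the first entry, followed by a non-maximum. So
  the permutations become lattice paths whose only down step is \<open>-1\<close>, weighted by the number of
  up steps immediately followed by a down step. Since the paths cannot jump downwards, their
  generating function factors over the heights: it is \<open>P ^ h * C\<close> from height \<open>h\<close>, where \<open>P\<close> counts
  the paths that descend one level for the first time at their end and \<open>C = 1 / (1 - P)\<close>. A first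
  step analysis gives \<open>P - P\<^sup>2 = z (1 - z + z q)\<close>. The first entry leads to an arbitrary height, so the
  permutations have the generating function \<open>1 + z (\<Sum>h. P ^ h * C) = 1 + z C\<^sup>2\<close>.
\<close>

section \<open>Avoidance of 321 read from left to right\<close>

lemma contains_321_iff:
  "contains_pattern p [3, 2, 1] \<longleftrightarrow>
     (\<exists>i j k. i < j \<and> j < k \<and> k < length p \<and> p ! j < p ! i \<and> p ! k < p ! j)"
proof
  assume "contains_pattern p [3, 2, 1]"
  then obtain f where f: "strict_mono_on {..<3} f" "\<forall>a<3. f a < length p"
    "\<forall>a<3. \<forall>b<3. p ! f a < p ! f b \<longleftrightarrow> [3, 2, 1::nat] ! a < [3, 2, 1] ! b"
    unfolding contains_pattern_def by (auto simp: eval_nat_numeral)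
  have "f 0 < f 1" "f 1 < f 2"
    using f(1) by (auto simp: strict_mono_on_def)
  moreover have "f 2 < length p" using f(2) by simp
  moreover have "p ! f 1 < p ! f 0" using f(3)[rule_format, of 1 0] by simp
  moreover have "p ! f 2 < p ! f 1" using f(3)[rule_format, of 2 1] by simp
  ultimately show "\<exists>i j k. i < j \<and> j < k \<and> k < length p \<and> p ! j < p ! i \<and> p ! k < p ! j"
    by blast
next
  assume "\<exists>i j k. i < j \<and> j < k \<and> k < length p \<and> p ! j < p ! i \<and> p ! k < p ! j"
  then obtain i j k where "i < j" "j < k" "k < length p" "p ! j < p ! i" "p ! k < p ! j"
    by blast
  then show "contains_pattern p [3, 2, 1]"
    unfolding contains_pattern_def
    by (intro exI[of _ "\<lambda>a. [i, j, k] ! a"])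
       (auto simp: strict_mono_on_def less_Suc_eq numeral_3_eq_3)
qed

text \<open>A pair \<open>xs ! k < xs ! j\<close> with \<open>xs ! j < m\<close> has both entries
  below \<open>m\<close>, so it is an inversion of the filtered word.\<close>

lemma sorted_filter_less_iff:
  fixes m :: "'a::linorder"
  shows "sorted (filter (\<lambda>y. y < m) xs) \<longleftrightarrow>
    \<not> (\<exists>j k. j < k \<and> k < length xs \<and> xs ! j < m \<and> xs ! k < xs ! j)"
proof (induction xs)
  case (Cons x xs)
  have "(\<exists>j k. j < k \<and> k < length (x # xs) \<and> (x # xs) ! j < m \<and> (x # xs) ! k < (x # xs) ! j)
    \<longleftrightarrow> (x < m \<and> (\<exists>k < length xs. xs ! k < x))
      \<or> (\<exists>j k. j < k \<and> k < length xs \<and> xs ! j < m \<and> xs ! k < xs ! j)" (is "?L \<longleftrightarrow> ?R")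
  proof
    assume ?L
    then obtain j k where "j < k" "k < length (x # xs)" "(x # xs) ! j < m"
      "(x # xs) ! k < (x # xs) ! j" by blast
    then show ?R by (cases j; cases k) auto
  next
    assume ?R
    then show ?L
    proof (elim disjE conjE exE)
      fix k assume "x < m" "k < length xs" "xs ! k < x"
      then show ?L by (intro exI[of _ 0] exI[of _ "Suc k"]) auto
    next
      fix j k assume "j < k" "k < length xs" "xs ! j < m" "xs ! k < xs ! j"
      then show ?L by (intro exI[of _ "Suc j"] exI[of _ "Suc k"]) auto
    qed
  qed
  moreover have "(\<exists>k < length xs. xs ! k < x) \<longleftrightarrow> (\<exists>y \<in> set xs. y < x)"
    by (metis in_set_conv_nth)
  moreover have "sorted (filter (\<lambda>y. y < m) (x # xs)) \<longleftrightarrow>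
      (x < m \<longrightarrow> (\<forall>y\<in>set xs. y < m \<longrightarrow> x \<le> y)) \<and> sorted (filter (\<lambda>y. y < m) xs)"
    by auto
  moreover have "(\<forall>y\<in>set xs. y < m \<longrightarrow> x \<le> y) \<longleftrightarrow> \<not> (\<exists>y\<in>set xs. y < x)" if "x < m"
    using that by force
  ultimately show ?case
    using Cons.IH by argo
qed simp

lemma avoids_321_Nil: "avoids_pattern [] [3, 2, 1]"
  by (simp add: contains_321_iff del: One_nat_def)

text \<open>An occurrence that uses \<open>x\<close> uses it as the 3, and its 2 and 1 then form an
  inversion among the entries below \<open>x\<close>.\<close>

lemma avoids_321_Cons:
  "avoids_pattern (x # xs) [3, 2, 1] \<longleftrightarrow>
     avoids_pattern xs [3, 2, 1] \<and> sorted (filter (\<lambda>y. y < x) xs)"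
proof -
  have "contains_pattern (x # xs) [3, 2, 1] \<longleftrightarrow> contains_pattern xs [3, 2, 1] \<or>
     (\<exists>j k. j < k \<and> k < length xs \<and> xs ! j < x \<and> xs ! k < xs ! j)" (is "_ \<longleftrightarrow> ?R")
  proof
    assume "contains_pattern (x # xs) [3, 2, 1]"
    then obtain i j k where "i < j" "j < k" "k < length (x # xs)" "(x # xs) ! j < (x # xs) ! i"
      "(x # xs) ! k < (x # xs) ! j" unfolding contains_321_iff by blast
    then show ?R
      unfolding contains_321_iff
      by (cases i; cases j; cases k) auto
  next
    assume ?R
    then show "contains_pattern (x # xs) [3, 2, 1]"
      unfolding contains_321_iff
    proof (elim disjE exE conjE)
      fix i j k assume "i < j" "j < k" "k < length xs" "xs ! j < xs ! i" "xs ! k < xs ! j"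
      then show "\<exists>i j k. i < j \<and> j < k \<and> k < length (x # xs) \<and>
          (x # xs) ! j < (x # xs) ! i \<and> (x # xs) ! k < (x # xs) ! j"
        by (intro exI[of _ "Suc i"] exI[of _ "Suc j"] exI[of _ "Suc k"]) auto
    next
      fix j k assume "j < k" "k < length xs" "xs ! j < x" "xs ! k < xs ! j"
      then show "\<exists>i j k. i < j \<and> j < k \<and> k < length (x # xs) \<and>
          (x # xs) ! j < (x # xs) ! i \<and> (x # xs) ! k < (x # xs) ! j"
        by (intro exI[of _ 0] exI[of _ "Suc j"] exI[of _ "Suc k"]) auto
    qed
  qed
  then show ?thesis
    by (auto simp: sorted_filter_less_iff simp del: One_nat_def)
qed

text \<open>
  \<open>extends m xs\<close>: the word \<open>xs\<close> may follow a prefix with maximum \<open>m\<close> and all missing values in \<open>xs\<close>.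
\<close>

fun extends :: "nat \<Rightarrow> nat list \<Rightarrow> bool" where
  "extends m [] \<longleftrightarrow> True"
| "extends m (x # xs) \<longleftrightarrow>
     (if m < x then extends x xs else (\<forall>y\<in>set xs. x < y) \<and> extends m xs)"

text \<open>If \<open>m < x\<close>, sortedness below \<open>x\<close> includes sortedness below
  \<open>m\<close>, so \<open>x\<close> takes over from \<open>m\<close>. If \<open>x < m\<close>,
  sortedness below \<open>m\<close> forces \<open>x\<close> to be the least remaining entry, and the
  condition for \<open>x\<close> itself becomes vacuous.\<close>

lemma extends_iff_avoids_321:
  "distinct xs \<Longrightarrow> m \<notin> set xs \<Longrightarrow>
     extends m xs \<longleftrightarrow> avoids_pattern (m # xs) [3, 2, 1]"
proof (induction xs arbitrary: m)
  case (Cons x xs)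
  show ?case
  proof (cases "m < x")
    case True
    have "sorted (filter (\<lambda>y. y < m) xs)" if "sorted (filter (\<lambda>y. y < x) xs)"
    proof -
      have "filter (\<lambda>y. y < m) xs = filter (\<lambda>y. y < m) (filter (\<lambda>y. y < x) xs)"
        using True by (auto intro: filter_cong)
      then show ?thesis using sorted_filter[of id] that by (metis list.map_id)
    qed
    then show ?thesis
      using True Cons by (auto simp: avoids_321_Cons simp del: One_nat_def)
  next
    case False
    then have "x < m" using Cons.prems by auto
    have "filter (\<lambda>y. y < x) xs = []" if "\<forall>y\<in>set xs. x < y"
      using that by (auto simp: filter_empty_conv)
    moreover have "(\<forall>y\<in>set xs. y < m \<longrightarrow> x \<le> y) \<longleftrightarrow> (\<forall>y\<in>set xs. x < y)"
      using \<open>x < m\<close> Cons.prems by (auto simp: order.order_iff_strict)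
    ultimately show ?thesis
      using False \<open>x < m\<close> Cons by (auto simp: avoids_321_Cons simp del: One_nat_def)
  qed
qed (simp add: avoids_321_Cons avoids_321_Nil del: One_nat_def)

section \<open>Peaks read from left to right\<close>

lemma pk_short [simp]: "pk [] = 0" "pk [x] = 0" "pk [x, y] = 0"
  by (simp_all add: pk_def)

lemma pk_Cons: "pk (x # y # z # xs) = of_bool (x < y \<and> z < y) + pk (y # z # xs)"
proof -
  let ?S = "\<lambda>p. {i. i + 2 < length p \<and> p ! i < p ! (i + 1) \<and> p ! (i + 1) > (p ! (i + 2) :: nat)}"
  have "?S (x # y # z # xs) = {i. i = 0 \<and> x < y \<and> z < y} \<union> Suc ` ?S (y # z # xs)" (is "?L = ?R")
  proof (rule set_eqI)
    fix i show "i \<in> ?L \<longleftrightarrow> i \<in> ?R" by (cases i) auto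
  qed
  moreover have "finite (?S (y # z # xs))"
    by (rule finite_subset[of _ "{..<length (y # z # xs)}"]) auto
  moreover have "card {i::nat. i = 0 \<and> x < y \<and> z < y} = of_bool (x < y \<and> z < y)"
    by (cases "x < y \<and> z < y") auto
  ultimately show ?thesis
    unfolding pk_def by (simp only:) (subst card_Un_disjoint, auto simp: card_image)
qed

text \<open>
  The flag tells whether the entry before the word is a new maximum that has a predecessor, and so
  becomes a peak if a smaller entry follows.
\<close>

fun ext_peaks :: "bool \<Rightarrow> nat \<Rightarrow> nat list \<Rightarrow> nat" where
  "ext_peaks b m [] = 0"
| "ext_peaks b m (x # xs) =
     (if m < x then ext_peaks True x xs else of_bool b + ext_peaks False m xs)"

text \<open>Joint induction: a new maximum leads to the second claim, any other entry to the first.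
  The case \<open>l = m\<close> covers the first entry of a permutation.\<close>

lemma pk_eq_ext_peaks:
  assumes "distinct xs" "m \<notin> set xs" "extends m xs"
  shows "l \<le> m \<Longrightarrow> pk (l # xs) = ext_peaks False m xs"
    and "a < m \<Longrightarrow> pk (a # m # xs) = ext_peaks True m xs"
  using assms
proof (induction xs arbitrary: l a m)
  case (Cons x xs)
  {
    case 1
    show ?case
    proof (cases "m < x")
      case True
      then show ?thesis using 1 Cons.IH(2)[of l x] by auto
    next
      case False
      \<comment> \<open>By \<open>extends\<close>, \<open>x\<close> lies below all of
        \<open>xs\<close> and so is not a peak.\<close>
      then have "pk (l # x # xs) = pk (x # xs)"
        using 1 by (cases xs) (auto simp: pk_Cons)
      then show ?thesis using 1 False Cons.IH(1)[of x m] by auto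
    qed
  next
    case 2
    show ?case
    proof (cases "m < x")
      case True
      then show ?thesis using 2 Cons.IH(2)[of m x] by (auto simp: pk_Cons)
    next
      case False
      then have "x < m" using 2 by auto
      then have "pk (m # x # xs) = pk (x # xs)"
        using 2 by (cases xs) (auto simp: pk_Cons)
      then show ?thesis using 2 \<open>x < m\<close> Cons.IH(1)[of x m] by (auto simp: pk_Cons)
    qed
  }
qed simp_all

section \<open>Peak polynomials of the completions of a prefix\<close>

definition ext_poly :: "bool \<Rightarrow> nat set \<Rightarrow> nat \<Rightarrow> rat poly" where
  "ext_poly b R m =
     (\<Sum>xs | xs \<in> permutations_of_set R \<and> extends m xs. monom 1 (ext_peaks b m xs))"

lemma sum_permutations_of_set_Cons:
  assumes "finite R" "R \<noteq> {}"
  shows "(\<Sum>xs\<in>permutations_of_set R. f xs) =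
    (\<Sum>x\<in>R. \<Sum>xs\<in>permutations_of_set (R - {x}). f (x # xs))"
proof -
  have "(\<Sum>xs\<in>permutations_of_set R. f xs) =
      (\<Sum>x\<in>R. sum f ((#) x ` permutations_of_set (R - {x})))"
    unfolding permutations_of_set_nonempty[OF assms(2)]
    using assms by (intro sum.UNION_disjoint) auto
  then show ?thesis
    by (simp add: sum.reindex)
qed

text \<open>Ranks map \<open>S\<close> bijectively onto \<open>{..<card S}\<close>: adding a new
  largest element changes no other rank.\<close>

lemma sum_rank:
  fixes S :: "'a::linorder set"
  assumes "finite S"
  shows "(\<Sum>x\<in>S. f (card {r\<in>S. r < x})) = (\<Sum>j<card S. f j)"
  using assms
proof (induction S rule: finite_linorder_max_induct)
  case (insert b A)
  have "{r \<in> insert b A. r < x} = {r\<in>A. r < x}" if "x \<in> A" for x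
    using insert that by auto
  moreover have "{r \<in> insert b A. r < b} = A"
    using insert by auto
  moreover have "b \<notin> A" using insert by auto
  ultimately show ?case
    using insert by (simp add: add.commute)
qed simp

lemma ext_poly_rec:
  assumes R: "finite R" "R \<noteq> {}" and m: "m \<notin> R"
  shows "ext_poly b R m = (\<Sum>x | x \<in> R \<and> m < x. ext_poly True (R - {x}) x) +
    (if Min R < m then monom 1 (of_bool b) * ext_poly False (R - {Min R}) m else 0)"
proof -
  define g where "g x = (\<Sum>xs\<in>permutations_of_set (R - {x}).
      if extends m (x # xs) then monom (1::rat) (ext_peaks b m (x # xs)) else 0)" for x
  have "ext_poly b R m = (\<Sum>x\<in>R. g x)"
    unfolding ext_poly_def g_def
    by (subst sum_permutations_of_set_Cons[OF R, symmetric]) (simp add: sum.If_cases Int_def)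
  also have "\<dots> = (\<Sum>x | x \<in> R \<and> m < x. g x) + (\<Sum>x | x \<in> R \<and> x < m. g x)"
  proof (subst sum.union_disjoint[symmetric])
    have "x < m \<or> m < x" if "x \<in> R" for x
      using that m by (metis linorder_neqE)
    then have "R = {x. x \<in> R \<and> m < x} \<union> {x. x \<in> R \<and> x < m}" by auto
    then show "(\<Sum>x\<in>R. g x) = sum g ({x. x \<in> R \<and> m < x} \<union> {x. x \<in> R \<and> x < m})"
      by (rule arg_cong)
  qed (use R in auto)
  also have "(\<Sum>x | x \<in> R \<and> m < x. g x) = (\<Sum>x | x \<in> R \<and> m < x. ext_poly True (R - {x}) x)"
    by (intro sum.cong) (auto simp: g_def ext_poly_def sum.If_cases Int_def)
  also have "(\<Sum>x | x \<in> R \<and> x < m. g x) = (\<Sum>x | x \<in> R \<and> x < m. if x = Min R then g x else 0)"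
  proof (intro sum.cong refl)
    fix x assume x: "x \<in> {x. x \<in> R \<and> x < m}"
    show "g x = (if x = Min R then g x else 0)"
    proof (cases "x = Min R")
      case False
      have "Min R \<in> R" "Min R < x"
        using R x False by (auto simp: order.strict_iff_order)
      \<comment> \<open>Placing \<open>x\<close> first would leave the smaller \<open>Min R\<close>
        for later, which \<open>extends\<close> forbids.\<close>
      then have "Min R \<in> set xs \<and> \<not> x < Min R" if "xs \<in> permutations_of_set (R - {x})" for xs
        using that by (simp add: permutations_of_set_def)
      then have "\<not> extends m (x # xs)" if "xs \<in> permutations_of_set (R - {x})" for xs
        using that x by auto
      then show ?thesis
        using False by (simp add: g_def del: extends.simps)
    qed simp
  qed
  also have "\<dots> = (if Min R < m then g (Min R) else 0)"
    using R by (auto simp: sum.delta)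
  also have "\<dots> = (if Min R < m then monom 1 (of_bool b) * ext_poly False (R - {Min R}) m else 0)"
  proof (cases "Min R < m")
    case True
    have "\<forall>y\<in>set xs. Min R < y" if "xs \<in> permutations_of_set (R - {Min R})" for xs
      using that R by (auto simp: permutations_of_set_def order.strict_iff_order)
    then have "g (Min R) = (\<Sum>xs\<in>permutations_of_set (R - {Min R}).
      if extends m xs then monom 1 (of_bool b) * monom 1 (ext_peaks False m xs) else 0)"
      unfolding g_def using True by (intro sum.cong) (auto simp: mult_monom)
    then show ?thesis
      using True by (simp add: ext_poly_def sum_distrib_left sum.If_cases Int_def)
  qed simp
  finally show ?thesis .
qed

lemma pk_poly_eq_sum:
  "pk_poly r n = (\<Sum>p | p \<in> permutations_of_set {1..n} \<and> avoids_pattern p r. monom 1 (pk p))"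
proof (rule poly_eqI)
  fix k
  have "{p \<in> permutations_of_set {1..n}. avoids_pattern p r \<and> pk p = k}
     = {p \<in> permutations_of_set {1..n}. avoids_pattern p r} \<inter> {p. pk p = k}" by auto
  then show "coeff (pk_poly r n) k =
    coeff (\<Sum>p | p \<in> permutations_of_set {1..n} \<and> avoids_pattern p r. monom 1 (pk p)) k"
    by (simp add: coeff_pk_poly coeff_sum a_pk_def sum.If_cases)
qed

lemma pk_poly_321_Suc:
  "pk_poly [3, 2, 1] (Suc n) = (\<Sum>x\<in>{1..Suc n}. ext_poly False ({1..Suc n} - {x}) x)"
proof -
  have "pk_poly [3, 2, 1] (Suc n) = (\<Sum>p\<in>permutations_of_set {1..Suc n}.
      if avoids_pattern p [3, 2, 1] then monom 1 (pk p) else 0)"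
    by (simp add: pk_poly_eq_sum sum.If_cases Int_def)
  also have "\<dots> = (\<Sum>x\<in>{1..Suc n}. \<Sum>xs\<in>permutations_of_set ({1..Suc n} - {x}).
      if avoids_pattern (x # xs) [3, 2, 1] then monom 1 (pk (x # xs)) else 0)"
    by (rule sum_permutations_of_set_Cons) auto
  also have "\<dots> = (\<Sum>x\<in>{1..Suc n}. \<Sum>xs\<in>permutations_of_set ({1..Suc n} - {x}).
      if extends x xs then monom 1 (ext_peaks False x xs) else 0)"
  proof (intro sum.cong refl)
    fix x xs assume "xs \<in> permutations_of_set ({1..Suc n} - {x})"
    then have "distinct xs" "x \<notin> set xs" by (auto simp: permutations_of_set_def)
    then show "(if avoids_pattern (x # xs) [3, 2, 1] then monom 1 (pk (x # xs)) else 0) =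
        (if extends x xs then monom (1::rat) (ext_peaks False x xs) else 0)"
      using pk_eq_ext_peaks(1)[of xs x x] extends_iff_avoids_321[of xs x] by simp
  qed
  finally show ?thesis
    by (simp add: ext_poly_def sum.If_cases Int_def)
qed

section \<open>Lattice paths and their generating functions\<close>

locale first_passage =
  fixes P :: "rat poly fract fps"
  assumes P0: "P $ 0 = 0"
    and P_eq: "P - P\<^sup>2 = z_var * (1 - z_var + z_var * q_var)"
begin

definition "C = inverse (1 - P)"

text \<open>
  \<open>Q\<close> is the analogue of \<open>P\<close> for paths that follow an up step: it differs from \<open>P\<close> only in the path
  consisting of a single down step, which has weight \<open>z q\<close> instead of \<open>z\<close>.
\<close>

definition "Q = P - z_var + z_var * q_var"

text \<open>Of the \<open>h\<close> first passages down to height 0, only the first can begin with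
  the down step that completes a peak at the preceding entry, so the flag turns one factor
  \<open>P\<close> into \<open>Q\<close>. At height 0 no down step can come next.\<close>

definition path_fps :: "bool \<Rightarrow> nat \<Rightarrow> rat poly fract fps" where
  "path_fps b h = (if b \<and> 0 < h then Q * P ^ (h - 1) * C else P ^ h * C)"

lemma C_eq: "(1 - P) * C = 1"
  unfolding C_def by (rule inverse_mult_eq_1') (simp add: P0)

lemma P_eq_C: "P = z_var * (1 - z_var + z_var * q_var) * C"
  using C_eq P_eq by algebra

text \<open>First step from height 1: down, or up to some j \<ge> 1 and then
  \<open>Q * P ^ (j - 1)\<close>; the powers of \<open>P\<close> sum to \<open>C\<close>.\<close>

lemma P_step: "P = z_var * Q * C + z_var"
  using C_eq P_eq unfolding Q_def by algebra

text \<open>From height 0 a path is empty, or a new maximum keeps height 0, or it rises to some j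
  \<ge> 1; the last case sums \<open>Q * P ^ (j - 1) * C\<close> to
  \<open>Q * C\<^sup>2\<close>.\<close>

lemma C_step: "C = 1 + z_var * C + z_var * Q * C\<^sup>2"
  using C_eq P_eq unfolding Q_def by algebra

lemma P_power_nth: "n < k \<Longrightarrow> (P ^ k * F) $ n = 0"
  using startsby_zero_power_prefix[OF P0] by (simp add: fps_mult_nth)

lemma Q0: "Q $ 0 = 0"
  by (simp add: Q_def P0)

text \<open>\<open>Q\<close> contributes one further factor \<open>z_var\<close>, hence
  \<open>n \<le> k\<close> instead of \<open>n < k\<close>.\<close>

lemma Q_P_power_nth: "n \<le> k \<Longrightarrow> (Q * P ^ k * F) $ n = 0"
proof -
  assume n: "n \<le> k"
  have "(Q * (P ^ k * F)) $ n = (\<Sum>i=0..n. Q $ i * (P ^ k * F) $ (n - i))"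
    by (rule fps_mult_nth)
  also have "\<dots> = 0"
  proof (intro sum.neutral ballI)
    fix i assume "i \<in> {0..n}"
    then show "Q $ i * (P ^ k * F) $ (n - i) = 0"
      using n by (cases "i = 0") (auto simp: Q0 intro!: P_power_nth)
  qed
  finally show ?thesis by (simp add: mult.assoc)
qed

text \<open>A geometric series in \<open>P\<close>, telescoped by
  \<open>C = C\<^sup>2 - P * C\<^sup>2\<close>.\<close>

lemma sum_path_True:
  assumes "0 < h"
  shows "(\<Sum>j=h..n. path_fps True j $ n) = (Q * P ^ (h - 1) * C\<^sup>2) $ n"
proof -
  have tel: "(\<Sum>j=h..<h+k. path_fps True j) = Q * P ^ (h - 1) * C\<^sup>2 - Q * P ^ (h + k - 1) * C\<^sup>2" for k
  proof (induction k)
    case (Suc k)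
    obtain g where g: "h = Suc g" using assms by (cases h) auto
    have "C = C\<^sup>2 - P * C\<^sup>2" using C_eq by algebra
    then have "Q * P ^ (g + k) * C = Q * P ^ (g + k) * (C\<^sup>2 - P * C\<^sup>2)"
      by (rule arg_cong)
    also have "\<dots> = Q * P ^ (g + k) * C\<^sup>2 - Q * P ^ (g + Suc k) * C\<^sup>2"
      by (simp add: algebra_simps)
    finally show ?case using Suc by (simp add: g path_fps_def)
  qed simp
  \<comment> \<open>Heights above \<open>n\<close> do not reach this coefficient. The bound
    \<open>h + Suc n\<close> is high enough for the telescoped remainder to vanish as well.\<close>
  have "(\<Sum>j=h..n. path_fps True j $ n) = (\<Sum>j=h..<h+Suc n. path_fps True j $ n)"
    by (rule sum.mono_neutral_left) (auto simp: path_fps_def not_le intro!: Q_P_power_nth)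
  also have "\<dots> = (Q * P ^ (h - 1) * C\<^sup>2) $ n - (Q * P ^ (h + Suc n - 1) * C\<^sup>2) $ n"
    by (simp only: fps_sum_nth[symmetric] tel fps_sub_nth)
  also have "(Q * P ^ (h + Suc n - 1) * C\<^sup>2) $ n = 0"
    by (rule Q_P_power_nth) simp
  finally show ?thesis by simp
qed

lemma sum_path_False: "(\<Sum>j\<le>n. path_fps False j $ n) = C\<^sup>2 $ n"
proof -
  have tel: "(\<Sum>j<k. path_fps False j) = C\<^sup>2 - P ^ k * C\<^sup>2" for k
  proof (induction k)
    case (Suc k)
    have "C = C\<^sup>2 - P * C\<^sup>2" using C_eq by algebra
    then have "P ^ k * C = P ^ k * (C\<^sup>2 - P * C\<^sup>2)"
      by (rule arg_cong)
    also have "\<dots> = P ^ k * C\<^sup>2 - P ^ Suc k * C\<^sup>2"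
      by (simp add: algebra_simps)
    finally show ?case using Suc by (simp add: path_fps_def)
  qed simp
  have "(\<Sum>j\<le>n. path_fps False j $ n) = C\<^sup>2 $ n - (P ^ Suc n * C\<^sup>2) $ n"
    by (simp only: fps_sum_nth[symmetric] tel fps_sub_nth lessThan_Suc_atMost[symmetric])
  also have "(P ^ Suc n * C\<^sup>2) $ n = 0"
    by (rule P_power_nth) simp
  finally show ?thesis by simp
qed

lemma path_fps_0: "path_fps b h $ 0 = of_bool (h = 0)"
proof -
  have "C $ 0 = 1" by (simp add: C_def P0)
  then show ?thesis by (auto simp: path_fps_def P0 Q0)
qed

lemma path_fps_Suc:
  "path_fps b h $ Suc n = (\<Sum>j=h..n. path_fps True j $ n) +
     (if h = 0 then 0 else to_fract (monom 1 (of_bool b)) * path_fps False (h - 1) $ n)"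
proof (cases h)
  case 0
  have "(\<Sum>j=0..n. path_fps True j $ n) = C $ n + (\<Sum>j=1..n. path_fps True j $ n)"
    by (simp add: sum.atLeast_Suc_atMost path_fps_def)
  also have "\<dots> = C $ n + (Q * C\<^sup>2) $ n"
    by (subst sum_path_True) auto
  also have "\<dots> = (1 + z_var * (C + Q * C\<^sup>2)) $ Suc n"
    by simp
  also have "1 + z_var * (C + Q * C\<^sup>2) = C"
    by (subst (3) C_step) (simp add: algebra_simps)
  finally show ?thesis using 0 by (simp add: path_fps_def)
next
  case (Suc g)
  define w :: "rat poly fract" where "w = to_fract (monom 1 (of_bool b))"
  have w: "w = (if b then to_fract [:0, 1:] else 1)"
    by (simp add: w_def monom_altdef)
  \<comment> \<open>\<open>P\<close> and \<open>Q\<close> have the same first step analysis; only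
    the weight \<open>w\<close> of an immediate down step differs.\<close>
  have "Q = z_var * Q * C + z_var * q_var"
    using P_step unfolding Q_def by algebra
  then have "(if b then Q else P) = z_var * (Q * C + fps_const w)"
    using P_step by (simp add: w algebra_simps)
  then have "path_fps b h = z_var * ((Q * C + fps_const w) * P ^ g * C)"
    by (cases b) (simp_all add: path_fps_def Suc mult.assoc)
  also have "\<dots> = z_var * (Q * P ^ g * C\<^sup>2 + fps_const w * (P ^ g * C))"
    by (simp add: algebra_simps power2_eq_square)
  finally have "path_fps b h $ Suc n = (Q * P ^ g * C\<^sup>2) $ n + w * (P ^ g * C) $ n"
    by simp
  then show ?thesis
    using sum_path_True[of h n] by (simp add: Suc w_def path_fps_def)
qed

text \<open>Only the size of \<open>R\<close> and the number of its elements below \<open>m\<close>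
  matter: \<open>ext_poly_rec\<close> turns into \<open>path_fps_Suc\<close>.\<close>

lemma to_fract_ext_poly:
  "finite R \<Longrightarrow> m \<notin> R \<Longrightarrow>
     to_fract (ext_poly b R m) = path_fps b (card {r\<in>R. r < m}) $ card R"
proof (induction "card R" arbitrary: R m b)
  case 0
  then show ?case by (simp add: ext_poly_def path_fps_0 Collect_conv_if)
next
  case (Suc n)
  let ?h = "card {r\<in>R. r < m}"
  let ?S = "{r\<in>R. m < r}"
  have ne: "R \<noteq> {}" using Suc.hyps by auto
  have *: "r < m \<or> m < r" if "r \<in> R" for r
    using that Suc.prems by (metis linorder_neqE)
  then have "R = {r\<in>R. r < m} \<union> ?S" by auto
  then have "card R = card ({r\<in>R. r < m} \<union> ?S)" by (rule arg_cong)
  also have "\<dots> = ?h + card ?S"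
    using Suc.prems by (intro card_Un_disjoint) auto
  finally have "card R = ?h + card ?S" .
  then have cS: "?h + card ?S = Suc n" using Suc.hyps by simp
  \<comment> \<open>The values between \<open>m\<close> and \<open>x\<close> become missing, so the
    height grows by the rank of \<open>x\<close> in \<open>?S\<close>.\<close>
  have up: "to_fract (ext_poly True (R - {x}) x) = path_fps True (?h + card {r\<in>?S. r < x}) $ n"
    if "x \<in> ?S" for x
  proof -
    have "{r \<in> R - {x}. r < x} = {r\<in>R. r < m} \<union> {r\<in>?S. r < x}"
      using that * by auto
    then have "card {r \<in> R - {x}. r < x} = card ({r\<in>R. r < m} \<union> {r\<in>?S. r < x})"
      by (rule arg_cong)
    also have "\<dots> = ?h + card {r\<in>?S. r < x}"
      using Suc.prems by (intro card_Un_disjoint) auto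
    finally show ?thesis
      using Suc.hyps(1)[of "R - {x}" x True] Suc.hyps(2)[symmetric] Suc.prems that by simp
  qed
  have "(\<Sum>x\<in>?S. to_fract (ext_poly True (R - {x}) x)) =
      (\<Sum>x\<in>?S. path_fps True (?h + card {r\<in>?S. r < x}) $ n)"
    by (intro sum.cong refl up)
  also have "\<dots> = (\<Sum>j<card ?S. path_fps True (?h + j) $ n)"
    using Suc.prems by (intro sum_rank[where f = "\<lambda>j. path_fps True (?h + j) $ n"]) auto
  also have "\<dots> = (\<Sum>j=?h..<?h + card ?S. path_fps True j $ n)"
    using sum.shift_bounds_nat_ivl[of "\<lambda>j. path_fps True j $ n" 0 ?h "card ?S"]
    by (simp add: add.commute lessThan_atLeast0)
  also have "\<dots> = (\<Sum>j=?h..n. path_fps True j $ n)"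
    by (simp add: cS atLeastLessThanSuc_atLeastAtMost)
  finally have up_sum: "(\<Sum>x\<in>?S. to_fract (ext_poly True (R - {x}) x)) =
      (\<Sum>j=?h..n. path_fps True j $ n)" .
  have h0: "?h = 0 \<longleftrightarrow> \<not> Min R < m"
    using Suc.prems ne by (auto simp: Min_less_iff)
  have down: "to_fract (ext_poly False (R - {Min R}) m) = path_fps False (?h - 1) $ n"
    if "Min R < m"
  proof -
    have "{r \<in> R - {Min R}. r < m} = {r\<in>R. r < m} - {Min R}" by auto
    then have "card {r \<in> R - {Min R}. r < m} = ?h - 1"
      using that ne Suc.prems by simp
    then show ?thesis
      using Suc.hyps(1)[of "R - {Min R}" m False] Suc.hyps(2)[symmetric] Suc.prems ne by simp
  qed
  show ?case
    using up_sum down h0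
    by (simp add: ext_poly_rec[OF Suc.prems(1) ne Suc.prems(2)] Suc.hyps(2)[symmetric]
        path_fps_Suc)
qed

lemma pk_gf_321: "pk_gf [3, 2, 1] = 1 + z_var * C\<^sup>2"
proof (rule fps_ext)
  fix n
  show "pk_gf [3, 2, 1] $ n = (1 + z_var * C\<^sup>2) $ n"
  proof (cases n)
    case 0
    have "{p. p = [] \<and> avoids_pattern p [3, 2, 1]} = {[]}"
      using avoids_321_Nil by auto
    then show ?thesis
      by (simp add: 0 pk_gf_def pk_poly_eq_sum)
  next
    case (Suc k)
    let ?S = "{1..Suc k}"
    have "to_fract (pk_poly [3, 2, 1] n) =
        (\<Sum>x\<in>?S. path_fps False (card {r\<in>?S. r < x}) $ k)"
    proof -
      have "to_fract (ext_poly False (?S - {x}) x) = path_fps False (card {r\<in>?S. r < x}) $ k"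
        if "x \<in> ?S" for x
      proof -
        have "{r\<in>?S - {x}. r < x} = {r\<in>?S. r < x}" by auto
        then show ?thesis
          using that by (simp add: to_fract_ext_poly)
      qed
      then show ?thesis
        unfolding Suc pk_poly_321_Suc to_fract_sum by (intro sum.cong refl)
    qed
    \<comment> \<open>The rank of the first entry is the initial height, and it takes each value up
      to \<open>k\<close> once.\<close>
    also have "\<dots> = (\<Sum>j<card ?S. path_fps False j $ k)"
      by (rule sum_rank) simp
    also have "\<dots> = C\<^sup>2 $ k"
      by (simp add: lessThan_Suc_atMost sum_path_False)
    finally show ?thesis by (simp add: Suc pk_gf_def)
  qed
qed

end

section \<open>Closed form from the quadratic equation\<close>

theorem theorem3:
  shows "pk_gf [3, 2, 1] =
    1 + z_var *
      (- ((- 1 + fps_sqrt (- 4 * z_var\<^sup>2 * q_var + 4 * z_var\<^sup>2 - 4 * z_var + 1)) /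
          (2 * z_var * (z_var * q_var - z_var + 1))))\<^sup>2"
proof -
  define s where "s = fps_sqrt (- 4 * z_var\<^sup>2 * q_var + 4 * z_var\<^sup>2 - 4 * z_var + 1)"
  define A where "A = z_var * (1 - z_var + z_var * q_var)"
  \<comment> \<open>The root of \<open>P - P\<^sup>2 = A\<close> with zero constant term; the
    radicand is \<open>1 - 4 * A\<close>.\<close>
  define P where "P = fps_const (1 / 2) * (1 - s)"
  have s: "s\<^sup>2 = - 4 * z_var\<^sup>2 * q_var + 4 * z_var\<^sup>2 - 4 * z_var + 1" "s $ 0 = 1"
    using fps_sqrt_iff[of "- 4 * z_var\<^sup>2 * q_var + 4 * z_var\<^sup>2 - 4 * z_var + 1" s]
    by (simp_all add: s_def power2_eq_square)
  have half: "2 * fps_const (1 / 2) = (1 :: rat poly fract fps)"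
    by (simp add: numeral_fps_const)
  have P0: "P $ 0 = 0" by (simp add: P_def s(2))
  have sP: "s = 1 - 2 * P" using half unfolding P_def by algebra
  have P_eq: "P - P\<^sup>2 = A"
    using half s(1) unfolding P_def A_def by algebra
  interpret first_passage P
    by standard (fact P0, fact P_eq[unfolded A_def])
  have "(1 - z_var + z_var * q_var) $ 0 = 1" by simp
  then have "1 - z_var + z_var * q_var \<noteq> 0" by force
  then have A0: "2 * A \<noteq> 0" unfolding A_def by simp
  \<comment> \<open>Combines \<open>s = 1 - 2 * P\<close> with \<open>P = A * C\<close>; the
    quotient in the theorem is therefore \<open>- C\<close>.\<close>
  have "- 1 + s = - C * (2 * A)"
    using P_eq_C sP unfolding A_def by algebra
  then have "(- 1 + s) / (2 * A) = - C"
    using A0 by (simp only: nonzero_mult_div_cancel_right not_False_eq_True)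
  then show ?thesis
    using pk_gf_321
    by (simp add: s_def A_def algebra_simps)
qed

end
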